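(* Let $s\geq t\geq 1$ be integers. If an $r$-regular graph $G$ has $K_{t,s}$ as a star complement for the eigenvalue $\mu=r$, then either $s=t=1$ and $G\cong C_3$, or $r=s=t+1$ and $G\cong K_{t+1,t+1}$.
   Context: All graphs are finite and simple; eigenvalues are eigenvalues of the adjacency matrix. If $\mu$ is an eigenvalue of a graph $G$ with multiplicity $k\geq 1$, a star set for $\mu$ in $G$ is a vertex subset $X\subseteq V(G)$ with $|X|=k$ such that $\mu$ is not an eigenvalue of the induced subgraph $G-X$; $H=G-X$ is then a star complement for $\mu$. "$G$ has $K_{t,s}$ as a star complement for $\mu$" means some star set $X$ for $\mu$ satisfies $G-X\cong K_{t,s}$. $C_3$ denotes the triangle. *)

theory Defs
  imports
    "Jordan_Normal_Form.Char_Poly"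
    "Jordan_Normal_Form.Matrix_Kernel"
    "Graph_Theory.Graph_Theory"
begin

text \<open>
  A finite simple graph is a digraph satisfying the locale predicate \<open>graph\<close> of
  \<open>Graph_Theory\<close>: finite, symmetric, without loops and without parallel arcs. An edge is thus
  represented by a pair of opposite arcs, and the out-degree of a vertex is its degree.
\<close>

definition regular_graph :: "nat \<Rightarrow> ('a, 'b) pre_digraph \<Rightarrow> bool" where
  "regular_graph r G \<longleftrightarrow> graph G \<and> (\<forall>v \<in> verts G. out_degree G v = r)"

text \<open>
  The property of being isomorphic to the cycle \<open>C\<^sub>n\<close>, stated in the same style as
  \<^const>\<open>complete_bipartite_digraph\<close> in the library.
\<close>

definition cycle_digraph :: "nat \<Rightarrow> ('a, 'b) pre_digraph \<Rightarrow> bool" (\<open>C\<^bsub>_\<^esub>\<close>) where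
  "cycle_digraph n G \<longleftrightarrow> n \<ge> 3 \<and> graph G \<and>
    (\<exists>f. bij_betw f {..<n} (verts G) \<and>
         arcs_ends G = {(f i, f j) | i j. i < n \<and> j < n \<and> (j = Suc i mod n \<or> i = Suc j mod n)})"

text \<open>
  The adjacency matrix depends on an enumeration of the vertices. We fix an arbitrary one;
  another choice conjugates the matrix by a permutation matrix, so that the eigenvalues and
  their multiplicities do not depend on it.
\<close>

definition vertex_list :: "('a, 'b) pre_digraph \<Rightarrow> 'a list" where
  "vertex_list G = (SOME vs. distinct vs \<and> set vs = verts G)"

definition adjacency_matrix :: "('a, 'b) pre_digraph \<Rightarrow> real mat" where
  "adjacency_matrix G =
    (let vs = vertex_list G; n = length vs
     in mat n n (\<lambda>(i, j). if (vs ! i, vs ! j) \<in> arcs_ends G then 1 else 0))"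

text \<open>
  The multiplicity of \<open>\<mu>\<close> is the dimension of the eigenspace \<open>ker (A - \<mu> I)\<close>. As the
  adjacency matrix of a graph is real and symmetric, it is also the multiplicity of \<open>\<mu>\<close> as a
  root of the characteristic polynomial.
\<close>

definition eigenvalue_multiplicity :: "('a, 'b) pre_digraph \<Rightarrow> real \<Rightarrow> nat" where
  "eigenvalue_multiplicity G \<mu> = kernel_dim (char_matrix (adjacency_matrix G) \<mu>)"

definition star_set :: "('a, 'b) pre_digraph \<Rightarrow> real \<Rightarrow> 'a set \<Rightarrow> bool" where
  "star_set G \<mu> X \<longleftrightarrow>
    eigenvalue (adjacency_matrix G) \<mu> \<and>
    X \<subseteq> verts G \<and>
    card X = eigenvalue_multiplicity G \<mu> \<and>
    \<not> eigenvalue (adjacency_matrix (G \<restriction> (verts G - X))) \<mu>"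

definition has_complete_bipartite_star_complement ::
    "('a, 'b) pre_digraph \<Rightarrow> nat \<Rightarrow> nat \<Rightarrow> real \<Rightarrow> bool" where
  "has_complete_bipartite_star_complement G t s \<mu> \<longleftrightarrow>
    (\<exists>X. star_set G \<mu> X \<and> K\<^bsub>t,s\<^esub> (G \<restriction> (verts G - X)))"

end

theory Submission
  imports Defs
begin

text \<open>
  An eigenfunction for the eigenvalue \<open>r\<close> of an \<open>r\<close>-regular graph is constant along arcs, and a
  star set is a minimal set of vertices on which only the zero eigenfunction vanishes. So no
  vertex \<open>x\<close> of the star set can have its value forced by the rest of the star set. Hence there are
  no arcs inside the star set; then each of its vertices is joined to the connected star complement,
  and there is only one such vertex \<open>x\<close>. By regularity, \<open>x\<close> is adjacent to all or to none of each
  side of the complete bipartite graph, and counting degrees leaves the two cases.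
\<close>

section \<open>Dimension of a kernel detected by few coordinates\<close>

text \<open>Restriction to the coordinates in \<open>I\<close> embeds the kernel into a space of
  dimension \<open>card I\<close>. Concretely, a basis with more than \<open>card I\<close> vectors
  would have restrictions satisfying a nontrivial linear relation, which by \<open>inj\<close> would
  hold for the basis vectors themselves.\<close>

lemma kernel_dim_le_card:
  fixes A :: "'k :: field mat"
  assumes A: "A \<in> carrier_mat nr nc" and I: "finite I" "I \<subseteq> {..<nc}"
    and inj: "\<And>v. v \<in> mat_kernel A \<Longrightarrow> (\<And>i. i \<in> I \<Longrightarrow> v $ i = 0) \<Longrightarrow> v = 0\<^sub>v nc"
  shows "kernel_dim A \<le> card I"
proof (rule ccontr)
  assume less: "\<not> kernel_dim A \<le> card I"
  interpret kernel nr nc A by unfold_locales (rule A)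
  obtain B where fin: "finite B" and basis: "basis B"
    using kernel_basis_exists[OF A] by blast
  have BK: "B \<subseteq> mat_kernel A" and indpt: "lin_indpt B"
    using basis unfolding Ker.basis_def by auto
  define k where "k = card B"
  have dim: "kernel_dim A = k"
    using Ker.dim_basis[OF fin basis] by (simp add: k_def)
  obtain b where b: "bij_betw b {..<k} B"
    using ex_bij_betw_nat_finite[OF fin] by (auto simp: k_def atLeast0LessThan)
  define l where "l = card I"
  obtain e where e: "bij_betw e {..<l} I"
    using ex_bij_betw_nat_finite[OF I(1)] by (auto simp: l_def atLeast0LessThan)
  have lk: "l < k" using less dim by (simp add: l_def)
  \<comment> \<open>Column \<open>j\<close> is the restriction of \<open>b j\<close> to
    \<open>I\<close>. The rows from \<open>l\<close> on are zero padding that makes the matrix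
    square, so that determinants apply; as \<open>l < k\<close>, there is such a row, and
    \<open>M\<close> is singular.\<close>
  define M where "M = mat k k (\<lambda>(i, j). if i < l then b j $ e i else 0)"
  have M: "M \<in> carrier_mat k k" by (simp add: M_def)
  have "transpose_mat M *\<^sub>v unit_vec k l = 0\<^sub>v k"
    using lk by (intro eq_vecI) (auto simp: M_def row_transpose)
  moreover have "unit_vec k l \<noteq> (0\<^sub>v k :: 'k vec)" using lk by simp
  ultimately have "det (transpose_mat M) = 0"
    using det_0_iff_vec_prod_zero[of "transpose_mat M" k] M
    by (metis transpose_carrier_mat unit_vec_carrier)
  then have "det M = 0" using det_transpose[OF M] by simp
  then obtain c where c: "c \<in> carrier_vec k" "c \<noteq> 0\<^sub>v k" "M *\<^sub>v c = 0\<^sub>v k"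
    using det_0_iff_vec_prod_zero[OF M] by auto
  \<comment> \<open>\<open>lincomb\<close> takes its coefficients from the basis vectors, so the
    null vector \<open>c\<close> is carried over along the enumeration \<open>b\<close>.\<close>
  define a where "a = (\<lambda>v. c $ inv_into {..<k} b v)"
  have a: "a (b j) = c $ j" if "j < k" for j
    using that bij_betw_inv_into_left[OF b] by (simp add: a_def)
  have index: "lincomb a B $ i = (\<Sum>j<k. c $ j * b j $ i)" if "i < nc" for i
  proof -
    have "lincomb a B $ i = (\<Sum>v\<in>B. a v * v $ i)"
      by (rule lincomb_index[OF that BK])
    also have "\<dots> = (\<Sum>j<k. a (b j) * b j $ i)"
      by (rule sum.reindex_bij_betw[OF b, symmetric])
    finally show ?thesis by (simp add: a)
  qed
  have "lincomb a B \<in> mat_kernel A"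
    using Ker.lincomb_closed[OF BK] by simp
  moreover have "lincomb a B $ i = 0" if i: "i \<in> I" for i
  proof -
    obtain j where j: "j < l" "i = e j"
      using bij_betw_imp_surj_on[OF e] i by blast
    have "0 = (M *\<^sub>v c) $ j" using c j lk by simp
    also have "\<dots> = (\<Sum>m<k. c $ m * b m $ i)"
      using j lk c(1) by (auto simp: M_def scalar_prod_def atLeast0LessThan mult.commute)
    finally show ?thesis using index[of i] i I(2) by auto
  qed
  ultimately have zero: "lincomb a B = 0\<^sub>v nc" by (rule inj)
  obtain j where j: "j < k" "c $ j \<noteq> 0"
    using c(1,2) by (metis carrier_vecD eq_vecI index_zero_vec)
  have "b j \<in> B" using j b by (auto simp: bij_betw_def)
  moreover have "a (b j) \<noteq> 0" using j a by simp
  ultimately have "lin_dep B"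
    unfolding Ker.lin_dep_def using fin zero by auto
  with indpt show False by simp
qed

section \<open>Eigenvectors as functions on the vertices\<close>

definition eigenfunction :: "('a, 'b) pre_digraph \<Rightarrow> real \<Rightarrow> ('a \<Rightarrow> real) \<Rightarrow> bool" where
  "eigenfunction G \<theta> f \<longleftrightarrow> (\<forall>u\<in>verts G. (\<Sum>w | (u, w) \<in> arcs_ends G. f w) = \<theta> * f u)"

context fin_digraph
begin

lemma arcs_ends_subset: "arcs_ends G \<subseteq> verts G \<times> verts G"
  by (auto simp: arcs_ends_conv)

lemma vertex_list: "distinct (vertex_list G)" "set (vertex_list G) = verts G"
  using someI_ex[OF finite_distinct_list[OF finite_verts]]
  by (auto simp: vertex_list_def conj_commute)

lemma adjacency_matrix_carrier:
  "adjacency_matrix G \<in> carrier_mat (length (vertex_list G)) (length (vertex_list G))"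
  by (simp add: adjacency_matrix_def Let_def)

definition vertex_vec :: "('a \<Rightarrow> real) \<Rightarrow> real vec" where
  "vertex_vec f = vec (length (vertex_list G)) (\<lambda>i. f (vertex_list G ! i))"

lemma vertex_vec_carrier [simp]: "vertex_vec f \<in> carrier_vec (length (vertex_list G))"
  by (simp add: vertex_vec_def)

lemma vertex_vec_surj:
  assumes "v \<in> carrier_vec (length (vertex_list G))"
  obtains f where "v = vertex_vec f"
proof
  let ?n = "length (vertex_list G)"
  have "inj_on ((!) (vertex_list G)) {..<?n}"
    using vertex_list(1) by (simp add: inj_on_def nth_eq_iff_index_eq)
  then show "v = vertex_vec (\<lambda>u. v $ inv_into {..<?n} ((!) (vertex_list G)) u)"
    using assms by (intro eq_vecI) (auto simp: vertex_vec_def)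
qed

lemma vertex_vec_eq_0_iff:
  "vertex_vec f = 0\<^sub>v (length (vertex_list G)) \<longleftrightarrow> (\<forall>u\<in>verts G. f u = 0)"
proof -
  have "vertex_vec f = 0\<^sub>v (length (vertex_list G)) \<longleftrightarrow>
      (\<forall>i<length (vertex_list G). f (vertex_list G ! i) = 0)"
    by (auto simp: vertex_vec_def vec_eq_iff)
  also have "\<dots> \<longleftrightarrow> (\<forall>u\<in>set (vertex_list G). f u = 0)"
    by (simp add: all_set_conv_all_nth)
  finally show ?thesis by (simp add: vertex_list)
qed

lemma char_matrix_mult_vertex_vec:
  "char_matrix (adjacency_matrix G) \<theta> *\<^sub>v vertex_vec f =
    vertex_vec (\<lambda>u. (\<Sum>w | (u, w) \<in> arcs_ends G. f w) - \<theta> * f u)"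
proof (rule eq_vecI)
  let ?vs = "vertex_list G" let ?n = "length ?vs"
  show "dim_vec (char_matrix (adjacency_matrix G) \<theta> *\<^sub>v vertex_vec f) =
      dim_vec (vertex_vec (\<lambda>u. (\<Sum>w | (u, w) \<in> arcs_ends G. f w) - \<theta> * f u))"
    using adjacency_matrix_carrier by (simp add: vertex_vec_def char_matrix_def)
  fix i
  assume "i < dim_vec (vertex_vec (\<lambda>u. (\<Sum>w | (u, w) \<in> arcs_ends G. f w) - \<theta> * f u))"
  then have i: "i < ?n" by (simp add: vertex_vec_def)
  let ?g = "\<lambda>w. if (?vs ! i, w) \<in> arcs_ends G then f w else 0"
  have bij: "bij_betw ((!) ?vs) {..<?n} (verts G)"
    using bij_betw_nth[OF vertex_list(1) refl vertex_list(2)[symmetric]] .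
  \<comment> \<open>The diagonal shift is kept apart from the adjacency entries: it contributes only
    at \<open>j = i\<close>, and what remains can be reindexed by vertices.\<close>
  have "(char_matrix (adjacency_matrix G) \<theta> *\<^sub>v vertex_vec f) $ i =
      (\<Sum>j<?n. ?g (?vs ! j) - (if j = i then \<theta> * f (?vs ! j) else 0))"
    using i adjacency_matrix_carrier
    by (auto simp: char_matrix_def vertex_vec_def adjacency_matrix_def Let_def scalar_prod_def
        atLeast0LessThan algebra_simps intro!: sum.cong)
  also have "\<dots> = (\<Sum>j<?n. ?g (?vs ! j)) - \<theta> * f (?vs ! i)"
    using i by (simp add: sum_subtractf)
  also have "(\<Sum>j<?n. ?g (?vs ! j)) = (\<Sum>w\<in>verts G. ?g w)"
    by (rule sum.reindex_bij_betw[OF bij])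
  also have "\<dots> = (\<Sum>w | (?vs ! i, w) \<in> arcs_ends G. f w)"
    using arcs_ends_subset by (intro sum.mono_neutral_cong_right) auto
  finally show "(char_matrix (adjacency_matrix G) \<theta> *\<^sub>v vertex_vec f) $ i =
      vertex_vec (\<lambda>u. (\<Sum>w | (u, w) \<in> arcs_ends G. f w) - \<theta> * f u) $ i"
    using i by (simp add: vertex_vec_def)
qed

lemma char_matrix_mult_vertex_vec_eq_0_iff:
  "char_matrix (adjacency_matrix G) \<theta> *\<^sub>v vertex_vec f = 0\<^sub>v (length (vertex_list G)) \<longleftrightarrow>
    eigenfunction G \<theta> f"
  by (simp add: char_matrix_mult_vertex_vec vertex_vec_eq_0_iff eigenfunction_def)

lemma eigenvalue_iff_eigenfunction:
  "eigenvalue (adjacency_matrix G) \<theta> \<longleftrightarrow> (\<exists>f. eigenfunction G \<theta> f \<and> (\<exists>u\<in>verts G. f u \<noteq> 0))"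
  unfolding eigenvalue_char_matrix[OF adjacency_matrix_carrier]
  by (metis char_matrix_mult_vertex_vec_eq_0_iff vertex_vec_carrier vertex_vec_eq_0_iff
      vertex_vec_surj)

text \<open>This is \<open>kernel_dim_le_card\<close> read on vertices: \<open>I\<close> consists of
  the positions of \<open>Y\<close> in the enumeration, and has as many elements as \<open>Y\<close>
  because the enumeration is distinct.\<close>

lemma eigenvalue_multiplicity_le_card:
  assumes Y: "Y \<subseteq> verts G"
    and inj: "\<And>f. eigenfunction G \<theta> f \<Longrightarrow> \<forall>y\<in>Y. f y = 0 \<Longrightarrow> \<forall>u\<in>verts G. f u = 0"
  shows "eigenvalue_multiplicity G \<theta> \<le> card Y"
proof -
  let ?vs = "vertex_list G" let ?n = "length ?vs"
  define I where "I = {i. i < ?n \<and> ?vs ! i \<in> Y}"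
  have C: "char_matrix (adjacency_matrix G) \<theta> \<in> carrier_mat ?n ?n"
    using adjacency_matrix_carrier by simp
  have im: "(!) ?vs ` I = Y"
  proof
    show "Y \<subseteq> (!) ?vs ` I"
    proof
      fix y assume "y \<in> Y"
      with Y vertex_list(2) have "y \<in> set ?vs" by blast
      then obtain i where "i < ?n" "y = ?vs ! i" by (metis in_set_conv_nth)
      with \<open>y \<in> Y\<close> show "y \<in> (!) ?vs ` I" by (simp add: I_def)
    qed
  qed (auto simp: I_def)
  have "inj_on ((!) ?vs) I"
    using vertex_list(1) by (simp add: inj_on_def nth_eq_iff_index_eq I_def)
  with im have card: "card Y = card I" by (metis card_image)
  have "eigenvalue_multiplicity G \<theta> \<le> card I"
    unfolding eigenvalue_multiplicity_def
  proof (rule kernel_dim_le_card[OF C])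
    fix v
    assume v: "v \<in> mat_kernel (char_matrix (adjacency_matrix G) \<theta>)"
      and 0: "\<And>i. i \<in> I \<Longrightarrow> v $ i = 0"
    obtain f where f: "v = vertex_vec f"
      using vertex_vec_surj mat_kernelD(1)[OF C v] by blast
    have "eigenfunction G \<theta> f"
      using mat_kernelD(2)[OF C v] f char_matrix_mult_vertex_vec_eq_0_iff by simp
    moreover have "f y = 0" if "y \<in> Y" for y
    proof -
      obtain i where "i \<in> I" "y = ?vs ! i" using im \<open>y \<in> Y\<close> by blast
      then show ?thesis using 0[of i] by (simp add: f vertex_vec_def I_def)
    qed
    ultimately show "v = 0\<^sub>v ?n" using inj f vertex_vec_eq_0_iff by blast
  qed (auto simp: I_def)
  with card show ?thesis by simp
qed

end

section \<open>Eigenfunctions vanishing on a star set\<close>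

lemma arcs_ends_induce_subgraph:
  "arcs_ends (G \<restriction> W) = arcs_ends G \<inter> W \<times> W"
  by (auto simp: arcs_ends_conv)

text \<open>Neighbours in \<open>X\<close> contribute 0 to every neighbour sum, so deleting them
  leaves the equations at the other vertices intact.\<close>

lemma eigenfunction_induce_subgraph:
  assumes "wf_digraph G" and f: "eigenfunction G \<theta> f" and 0: "\<forall>x\<in>X. f x = 0"
    and fin: "finite (verts G)"
  shows "eigenfunction (G \<restriction> (verts G - X)) \<theta> f"
  unfolding eigenfunction_def
proof
  interpret wf_digraph G by fact
  fix u assume u: "u \<in> verts (G \<restriction> (verts G - X))"
  have "{w. (u, w) \<in> arcs_ends G} \<subseteq> verts G" by (auto simp: arcs_ends_conv)
  then have "(\<Sum>w | (u, w) \<in> arcs_ends (G \<restriction> (verts G - X)). f w) = (\<Sum>w | (u, w) \<in> arcs_ends G. f w)"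
    using fin 0 u finite_subset
    by (intro sum.mono_neutral_left) (auto simp: arcs_ends_induce_subgraph)
  then show "(\<Sum>w | (u, w) \<in> arcs_ends (G \<restriction> (verts G - X)). f w) = \<theta> * f u"
    using f u by (simp add: eigenfunction_def)
qed

text \<open>Such an \<open>f\<close> remains an eigenfunction on the star complement, where \<theta>
  is not an eigenvalue.\<close>

lemma star_set_eigenfunction_eq_0:
  assumes "fin_digraph G" and X: "star_set G \<theta> X" and f: "eigenfunction G \<theta> f"
    and 0: "\<forall>x\<in>X. f x = 0"
  shows "\<forall>u\<in>verts G. f u = 0"
proof -
  interpret fin_digraph G by fact
  interpret H: fin_digraph "G \<restriction> (verts G - X)"
    by unfold_locales auto
  have "\<forall>u\<in>verts G - X. f u = 0"
    using X H.eigenvalue_iff_eigenfunction[of \<theta>]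
      eigenfunction_induce_subgraph[OF wf_digraph f 0 finite_verts]
    by (auto simp: star_set_def)
  with 0 show ?thesis by blast
qed

section \<open>Eigenfunctions for the degree of a regular graph\<close>

text \<open>Without parallel arcs, \<open>head G\<close> is injective on the arcs leaving
  \<open>u\<close>, so the out-degree counts neighbours.\<close>

lemma card_neighbours_regular:
  assumes "regular_graph r G" "u \<in> verts G"
  shows "card {w. (u, w) \<in> arcs_ends G} = r"
proof -
  interpret graph G using assms by (simp add: regular_graph_def)
  have "inj_on (head G) (out_arcs G u)"
    using no_multi_arcs by (auto simp: inj_on_def out_arcs_def arc_to_ends_def)
  moreover have "head G ` out_arcs G u = {w. (u, w) \<in> arcs_ends G}"
    by (auto simp: out_arcs_def arcs_ends_conv)
  ultimately show ?thesis
    using assms by (metis card_image out_degree_def regular_graph_def)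
qed

text \<open>
  The sum of \<open>(f u - f w)\<^sup>2\<close> over all arcs is twice the Laplacian quadratic form of \<open>f\<close>,
  which vanishes.
\<close>

lemma regular_eigenfunction_adjacent_eq:
  assumes G: "regular_graph r G" and f: "eigenfunction G (real r) f"
    and uw: "(u, w) \<in> arcs_ends G"
  shows "f u = f w"
proof -
  interpret graph G using G by (simp add: regular_graph_def)
  let ?E = "arcs_ends G"
  let ?N = "\<lambda>u. {w. (u, w) \<in> ?E}"
  have N: "?N u \<subseteq> verts G" for u using arcs_ends_subset by auto
  have finN: "finite (?N u)" for u using N finite_verts finite_subset by blast
  have E: "?E = Sigma (verts G) ?N" using arcs_ends_subset by auto
  have finE: "finite ?E" by (subst E) (use finN in auto)
  have E_sum: "(\<Sum>(u, w)\<in>?E. h u w) = (\<Sum>u\<in>verts G. \<Sum>w\<in>?N u. h u w)"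
    for h :: "'a \<Rightarrow> 'a \<Rightarrow> real"
    using sum.Sigma[of "verts G" ?N h] finN by (simp add: E[symmetric])
  have sq: "(\<Sum>(u, w)\<in>?E. (f u)\<^sup>2) = r * (\<Sum>u\<in>verts G. (f u)\<^sup>2)"
    unfolding E_sum using card_neighbours_regular[OF G] by (simp add: sum_distrib_left)
  \<comment> \<open>Reversing arcs is a bijection of the symmetric arc relation.\<close>
  have "(\<Sum>(u, w)\<in>?E. (f w)\<^sup>2) = (\<Sum>(u, w)\<in>?E. (f u)\<^sup>2)"
    by (rule sum.reindex_bij_witness[where i = prod.swap and j = prod.swap])
      (auto intro: arcs_ends_symmetric[OF sym_arcs])
  \<comment> \<open>The eigenvector equation at \<open>u\<close> evaluates the inner sum over
    \<open>w\<close>. The mixed sum thus equals both sums of squares, and the expanded square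
    cancels.\<close>
  moreover have "(\<Sum>(u, w)\<in>?E. f u * f w) = r * (\<Sum>u\<in>verts G. (f u)\<^sup>2)"
  proof -
    have "(\<Sum>w\<in>?N u. f u * f w) = r * (f u)\<^sup>2" if "u \<in> verts G" for u
      using f that by (simp add: eigenfunction_def sum_distrib_left[symmetric] power2_eq_square)
    then show ?thesis unfolding E_sum by (simp add: sum_distrib_left)
  qed
  moreover have "(\<Sum>(u, w)\<in>?E. (f u - f w)\<^sup>2) =
      (\<Sum>(u, w)\<in>?E. (f u)\<^sup>2) + (\<Sum>(u, w)\<in>?E. (f w)\<^sup>2) - 2 * (\<Sum>(u, w)\<in>?E. f u * f w)"
    by (simp add: case_prod_unfold power2_diff sum.distrib sum_subtractf sum_distrib_left mult.assoc)
  ultimately have "(\<Sum>(u, w)\<in>?E. (f u - f w)\<^sup>2) = 0" using sq by simp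
  then have "\<forall>e\<in>?E. (case e of (u, w) \<Rightarrow> (f u - f w)\<^sup>2) = 0"
    using finE by (subst (asm) sum_nonneg_eq_0_iff) auto
  with uw show ?thesis by fastforce
qed

section \<open>Minimality of star sets\<close>

text \<open>By \<open>det\<close>, the set \<open>X - {x}\<close> would already detect every nonzero
  eigenfunction, bounding the multiplicity by \<open>card X - 1\<close>.\<close>

lemma star_set_minimal:
  assumes "fin_digraph G" and X: "star_set G \<theta> X" and x: "x \<in> X"
    and det: "\<And>f. eigenfunction G \<theta> f \<Longrightarrow> \<forall>y\<in>X - {x}. f y = 0 \<Longrightarrow> f x = 0"
  shows False
proof -
  interpret fin_digraph G by fact
  have sub: "X \<subseteq> verts G" and card: "card X = eigenvalue_multiplicity G \<theta>"
    using X by (auto simp: star_set_def)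
  have "eigenvalue_multiplicity G \<theta> \<le> card (X - {x})"
  proof (rule eigenvalue_multiplicity_le_card)
    fix f assume f: "eigenfunction G \<theta> f" "\<forall>y\<in>X - {x}. f y = 0"
    then have "\<forall>y\<in>X. f y = 0" using det[OF f] by blast
    then show "\<forall>u\<in>verts G. f u = 0"
      using star_set_eigenfunction_eq_0[OF fin_digraph X f(1)] by blast
  qed (use sub in auto)
  also have "\<dots> < card X"
    using x sub finite_subset[OF sub finite_verts] by (meson card_Diff1_less)
  finally show False using card by simp
qed

section \<open>Regular graphs with a complete bipartite star complement\<close>

theorem theorem3p4:
  fixes G :: "('a, 'b) pre_digraph" and r s t :: nat
  assumes "1 \<le> t" and "t \<le> s"
    and "regular_graph r G"
    and "has_complete_bipartite_star_complement G t s (real r)"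
  shows "(s = 1 \<and> t = 1 \<and> C\<^bsub>3\<^esub> G) \<or> (r = s \<and> s = t + 1 \<and> K\<^bsub>t + 1,t + 1\<^esub> G)"
proof -
  note G = \<open>regular_graph r G\<close>
  interpret graph G using G by (simp add: regular_graph_def)
  let ?E = "arcs_ends G"
  let ?N = "\<lambda>u. {w. (u, w) \<in> ?E}"
  have sym: "(u, w) \<in> ?E \<longleftrightarrow> (w, u) \<in> ?E" for u w
    using arcs_ends_symmetric[OF sym_arcs] by blast
  have irrefl: "(u, u) \<notin> ?E" for u
    using no_loops by (force simp: arcs_ends_conv)
  obtain X U W where X: "star_set G (real r) X"
    and UW: "verts G - X = U \<union> W" "U \<inter> W = {}" "card U = t" "card W = s"
      "?E \<inter> (U \<union> W) \<times> (U \<union> W) = U \<times> W \<union> W \<times> U"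
    using assms(4) unfolding has_complete_bipartite_star_complement_def
      complete_bipartite_digraph_def arcs_ends_induce_subgraph by auto
  have XV: "X \<subseteq> verts G" using X by (simp add: star_set_def)
  have fin: "finite U" "finite W"
    using UW(1) finite_verts by (metis finite_Diff finite_Un)+
  obtain u0 w0 where u0: "u0 \<in> U" and w0: "w0 \<in> W"
    using UW(3,4) assms(1,2) by fastforce
  have deg: "card (?N u) = r" if "u \<in> verts G" for u
    using card_neighbours_regular[OF G that] .
  have N: "?N u \<subseteq> verts G" for u using arcs_ends_subset by auto
  have finN: "finite (?N u)" for u using N finite_verts finite_subset by blast
  have "w0 \<in> ?N u0" using UW(5) u0 w0 by blast
  moreover have "u0 \<in> verts G" using UW(1) u0 by blast
  ultimately have r: "r > 0" using deg finN by (metis card_gt_0_iff empty_iff)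
  \<comment> \<open>The star complement is connected: each vertex of \<open>W\<close> is adjacent to
    \<open>u0\<close>, and each vertex of \<open>U\<close> to \<open>w0\<close>.\<close>
  have const: "f h = f u0"
    if "eigenfunction G (real r) f" "h \<in> U \<union> W" for f h
  proof -
    have adj: "f a = f b" if "a \<in> U" "b \<in> W" for a b
      using regular_eigenfunction_adjacent_eq[OF G \<open>eigenfunction G r f\<close>] UW(5) that by blast
    show ?thesis using that(2) adj u0 w0 by (metis UnE)
  qed
  \<comment> \<open>An arc from \<open>x\<close> to some \<open>y\<close> in \<open>X\<close> would
    force \<open>f x = f y\<close>, so vanishing on \<open>X - {x}\<close> would imply
    \<open>f x = 0\<close>.\<close>
  have NX: "?N x \<subseteq> U \<union> W" if x: "x \<in> X" for x
  proof (rule ccontr)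
    assume "\<not> ?N x \<subseteq> U \<union> W"
    then obtain y where y: "(x, y) \<in> ?E" "y \<in> X" using N UW(1) by blast
    with irrefl have "y \<noteq> x" by blast
    with y show False
      using star_set_minimal[OF fin_digraph X x] regular_eigenfunction_adjacent_eq[OF G] by fastforce
  qed
  \<comment> \<open>Since \<open>r > 0\<close>, \<open>x\<close> has a neighbour, and by
    \<open>NX\<close> it lies in the star complement, where \<open>f\<close> is constant.\<close>
  have X_const: "f x = f u0" if "eigenfunction G (real r) f" "x \<in> X" for f x
  proof -
    have "?N x \<noteq> {}" using deg r that(2) XV by fastforce
    then obtain h where "(x, h) \<in> ?E" by blast
    then show ?thesis
      using NX[OF that(2)] const[OF that(1)] regular_eigenfunction_adjacent_eq[OF G that(1)]
      by fastforce
  qed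
  have unique: "x = y" if "x \<in> X" "y \<in> X" for x y
  proof (rule ccontr)
    assume "x \<noteq> y"
    show False
    proof (rule star_set_minimal[OF fin_digraph X that(1)])
      fix f
      assume f: "eigenfunction G (real r) f" and 0: "\<forall>z\<in>X - {x}. f z = 0"
      have "f y = 0" using 0 that(2) \<open>x \<noteq> y\<close> by blast
      then show "f x = 0" using X_const[OF f that(1)] X_const[OF f that(2)] by simp
    qed
  qed
  have "X \<noteq> {}"
  proof
    assume "X = {}"
    then have "\<not> eigenvalue (adjacency_matrix G) (real r)"
      using star_set_eigenfunction_eq_0[OF fin_digraph X] eigenvalue_iff_eigenfunction by blast
    with X show False by (simp add: star_set_def)
  qed
  then obtain x where x: "X = {x}" using unique by blast
  have V: "verts G = insert x (U \<union> W)" and xUW: "x \<notin> U" "x \<notin> W"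
    using UW(1) x XV by auto
  have NU: "?N u = (if (u, x) \<in> ?E then insert x W else W)" if "u \<in> U" for u
    using N[of u] V UW(2,5) that by auto
  have NW: "?N w = (if (w, x) \<in> ?E then insert x U else U)" if "w \<in> W" for w
    using N[of w] V UW(2,5) that by auto
  \<comment> \<open>A vertex of \<open>U\<close> has \<open>s\<close> neighbours in \<open>W\<close>
    and at most \<open>x\<close> besides, so whether it is adjacent to \<open>x\<close> depends on
    \<open>r\<close> alone. The same holds for \<open>W\<close> with \<open>t\<close>.\<close>
  have degU: "(u, x) \<in> ?E \<longleftrightarrow> r = s + 1" "r = s \<or> r = s + 1" if "u \<in> U" for u
    using deg[of u] NU[OF that] that V fin xUW UW(4) by (auto split: if_splits)
  have degW: "(w, x) \<in> ?E \<longleftrightarrow> r = t + 1" "r = t \<or> r = t + 1" if "w \<in> W" for w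
    using deg[of w] NW[OF that] that V fin xUW UW(3) by (auto split: if_splits)
  have Nx: "?N x = (if r = s + 1 then U else {}) \<union> (if r = t + 1 then W else {})"
    using NX[of x] x degU(1) degW(1) sym by auto
  have degx: "r = (if r = s + 1 then t else 0) + (if r = t + 1 then s else 0)"
    using deg[of x] V fin UW(2-4) unfolding Nx
    by (auto simp: card_Un_disjoint split: if_splits)
  have E_iff: "(a, b) \<in> ?E \<longleftrightarrow> (a \<in> U \<and> b \<in> W) \<or> (a \<in> W \<and> b \<in> U)
      \<or> (a = x \<and> b \<in> ?N x) \<or> (b = x \<and> a \<in> ?N x)" for a b
  proof (cases "a = x \<or> b = x")
    case True
    then show ?thesis using sym xUW by blast
  next
    case False
    then have "(a, b) \<in> ?E \<longleftrightarrow> (a, b) \<in> ?E \<inter> (U \<union> W) \<times> (U \<union> W)"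
      using arcs_ends_subset V by blast
    with False show ?thesis unfolding UW(5) by blast
  qed
  \<comment> \<open>If \<open>x\<close> sees both sides, then \<open>s = t\<close> and
    \<open>t + s = s + 1\<close>, the triangle. If it sees only \<open>U\<close>, then
    \<open>s + 1 = t\<close>, against \<open>t \<le> s\<close>. If it sees only \<open>W\<close>,
    then \<open>r = s = t + 1\<close>. If it sees neither, then \<open>r = 0\<close>.\<close>
  have "r = s + 1 \<longrightarrow> r = t + 1 \<longrightarrow> r = t + s" "r = s + 1 \<longrightarrow> r \<noteq> t + 1 \<longrightarrow> r = t"
    "r \<noteq> s + 1 \<longrightarrow> r = t + 1 \<longrightarrow> r = s" "r \<noteq> s + 1 \<longrightarrow> r \<noteq> t + 1 \<longrightarrow> r = 0"
    using degx by presburger+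
  with degU(2)[OF u0] degW(2)[OF w0] assms(1,2) r
  have "s = 1 \<and> t = 1 \<and> r = 2 \<or> r = s \<and> s = t + 1" by presburger
  then consider "s = 1" "t = 1" "r = 2" | "r = s" "s = t + 1" by blast
  then show ?thesis
  proof cases
    case 1
    have U: "U = {u0}" and W: "W = {w0}"
      using UW(3,4) 1 u0 w0 by (metis card_1_singletonE singletonD)+
    have ne: "u0 \<noteq> w0" "x \<noteq> u0" "x \<noteq> w0" using xUW U W UW(2) by auto
    define f where "f = (\<lambda>i::nat. if i = 0 then x else if i = 1 then u0 else w0)"
    have l3: "{..<3} = {0, 1, 2 :: nat}" by auto
    have less3: "i < 3 \<longleftrightarrow> i = 0 \<or> i = 1 \<or> i = 2" for i :: nat by auto
    have bij: "bij_betw f {..<3} (verts G)"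
      using ne by (auto simp: bij_betw_def l3 f_def V U W inj_on_def)
    have E: "?E = {(x, u0), (x, w0), (u0, x), (w0, x), (u0, w0), (w0, u0)}"
    proof -
      have "?N x = {u0, w0}" using Nx 1 U W by auto
      then have "(a, b) \<in> ?E \<longleftrightarrow> a = u0 \<and> b = w0 \<or> a = w0 \<and> b = u0
          \<or> a = x \<and> (b = u0 \<or> b = w0) \<or> b = x \<and> (a = u0 \<or> a = w0)" for a b
        using E_iff[of a b] U W by blast
      then show ?thesis by (auto simp only: set_eq_iff split_paired_All insert_iff empty_iff prod.inject)
    qed
    have image: "{(f i, f j) | i j. (i, j) \<in> P} = (\<lambda>(i, j). (f i, f j)) ` P" for P
      by force
    \<comment> \<open>Modulo 3, any two distinct indices are cyclically consecutive, so all six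
      ordered pairs occur.\<close>
    have "{(f i, f j) | i j. i < 3 \<and> j < 3 \<and> (j = Suc i mod 3 \<or> i = Suc j mod 3)} =
        (\<lambda>(i, j). (f i, f j)) ` {(0, 1), (0, 2), (1, 0), (2, 0), (1, 2), (2, 1)}"
    proof -
      have "i < 3 \<and> j < 3 \<and> (j = Suc i mod 3 \<or> i = Suc j mod 3) \<longleftrightarrow>
          (i, j) \<in> {(0, 1), (0, 2), (1, 0), (2, 0), (1, 2), (2, 1)}" for i j
        unfolding less3 by auto
      then show ?thesis by (simp only: image)
    qed
    also have "\<dots> = ?E" by (simp add: E f_def)
    finally have "C\<^bsub>3\<^esub> G"
      unfolding cycle_digraph_def using bij graph_axioms by (intro conjI exI[of _ f]) simp_all
    with 1 show ?thesis by simp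
  next
    case 2
    \<comment> \<open>Here \<open>r = t + 1\<close> but \<open>r\<close> is not
      \<open>s + 1\<close>, so \<open>x\<close> joins the side of \<open>U\<close> and brings it up
      to \<open>t + 1\<close> vertices.\<close>
    have "?N x = W" using Nx 2 by simp
    have "(a, b) \<in> ?E \<longleftrightarrow> (a, b) \<in> insert x U \<times> W \<union> W \<times> insert x U" for a b
      using E_iff[of a b] unfolding \<open>?N x = W\<close> by blast
    then have "?E = insert x U \<times> W \<union> W \<times> insert x U" by (simp add: set_eq_iff)
    moreover have "verts G = insert x U \<union> W" "insert x U \<inter> W = {}" using V xUW UW(2) by auto
    moreover have "card (insert x U) = t + 1" "card W = t + 1" using UW(3,4) fin xUW 2 by auto
    ultimately have "K\<^bsub>t + 1,t + 1\<^esub> G"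
      unfolding complete_bipartite_digraph_def using graph_axioms by blast
    with 2 show ?thesis by simp
  qed
qed

end
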